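(* Let $\{\gamma_k\}_{k\in\mathbb{N}}$ be a sequence of non-negative reals with $\gamma_k\to0$ and let $\mu_\gamma$ be the associated uniform probability measure on $X$. A point $x \in X$ is a generalized mode of $\mu_\gamma$ if and only if $x \in E_\gamma$.
   Context: $X := \{x=\{x_k\}_{k\in\mathbb{N}} \in \ell^\infty: \lim_{k\to\infty} x_k = 0\}$ (i.e. $X=c_0$), endowed with the norm $\|x\|_\infty=\sup_k|x_k|$; $e_k$ denotes the $k$-th standard unit vector and $B^\delta(x)$ the open ball of radius $\delta$ around $x$. The measure $\mu_\gamma$ is the law on $X$ of the random variable $\xi := \sum_{k=1}^\infty \gamma_k \xi_k e_k$, where the $\xi_k \sim \mathcal{U}[-1,1]$ are independent and uniformly distributed on $[-1,1]$ (the series converges almost surely in $X$). Further, $E_\gamma := \{x \in X : |x_k| \le \gamma_k \text{ for all } k \in \mathbb{N}\}$. A point $\hat x\in X$ is a generalized mode of a probability measure $\mu$ on $X$ if for every sequence $\{\delta_n\}_{n\in\mathbb{N}}\subset(0,\infty)$ with $\delta_n\to 0$ there exists a sequence $\{w_n\}_{n\in\mathbb{N}}\subset X$ with $w_n\to\hat x$ in $X$ and $\lim_{n\to\infty}\mu(B^{\delta_n}(w_n))/M^{\delta_n}=1$, where $M^\delta := \sup_{x\in X}\mu(B^\delta(x))$. *)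

theory Defs
  imports "HOL-Probability.Probability"
begin

typedef c0 = "{x :: nat \<Rightarrow> real. x \<longlonglongrightarrow> 0}"
  morphisms c0_nth Abs_c0
  by (rule exI[of _ "\<lambda>_. 0"]) simp

setup_lifting type_definition_c0

lemma c0_nth_tendsto: "c0_nth x \<longlonglongrightarrow> 0"
  using c0_nth[of x] by simp

lemma bdd_above_c0_nth: "bdd_above (range (\<lambda>k. \<bar>c0_nth x k\<bar>))"
proof -
  have "Bseq (c0_nth x)"
    using c0_nth_tendsto convergentI convergent_imp_Bseq by blast
  then obtain B where B: "\<And>k. \<bar>c0_nth x k\<bar> \<le> B"
    by (auto simp: Bseq_def)
  show ?thesis
    using B by (intro bdd_aboveI[of _ B]) auto
qed

instantiation c0 :: real_normed_vector
begin

lift_definition zero_c0 :: c0 is "\<lambda>_. 0"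
  by simp

lift_definition plus_c0 :: "c0 \<Rightarrow> c0 \<Rightarrow> c0" is "\<lambda>x y k. x k + y k"
  using tendsto_add by fastforce

lift_definition uminus_c0 :: "c0 \<Rightarrow> c0" is "\<lambda>x k. - x k"
  using tendsto_minus by fastforce

lift_definition minus_c0 :: "c0 \<Rightarrow> c0 \<Rightarrow> c0" is "\<lambda>x y k. x k - y k"
  using tendsto_diff by fastforce

lift_definition scaleR_c0 :: "real \<Rightarrow> c0 \<Rightarrow> c0" is "\<lambda>r x k. r * x k"
  by (rule tendsto_mult_right_zero)

definition norm_c0 :: "c0 \<Rightarrow> real" where
  "norm_c0 x = (SUP k. \<bar>c0_nth x k\<bar>)"

definition sgn_c0 :: "c0 \<Rightarrow> c0" where
  "sgn_c0 x = inverse (norm x) *\<^sub>R x"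

definition dist_c0 :: "c0 \<Rightarrow> c0 \<Rightarrow> real" where
  "dist_c0 x y = norm (x - y)"

definition uniformity_c0 :: "(c0 \<times> c0) filter" where
  "uniformity_c0 = (INF e\<in>{0<..}. principal {(x, y). dist x y < e})"

definition open_c0 :: "c0 set \<Rightarrow> bool" where
  "open_c0 U = (\<forall>x\<in>U. eventually (\<lambda>(x', y). x' = x \<longrightarrow> y \<in> U) uniformity)"

instance
proof
  fix x y z :: c0 and a b :: real and U :: "c0 set"
  show "x + y + z = x + (y + z)" "x + y = y + x" "0 + x = x" "- x + x = 0" "x - y = x + - y"
    "a *\<^sub>R (x + y) = a *\<^sub>R x + a *\<^sub>R y" "(a + b) *\<^sub>R x = a *\<^sub>R x + b *\<^sub>R x"
    "a *\<^sub>R b *\<^sub>R x = (a * b) *\<^sub>R x" "1 *\<^sub>R x = x"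
    by (transfer; auto simp: algebra_simps)+
  show "sgn x = inverse (norm x) *\<^sub>R x" "dist x y = norm (x - y)"
    "uniformity = (INF e\<in>{0<..}. principal {(x, y). dist (x :: c0) y < e})"
    "open U = (\<forall>x\<in>U. eventually (\<lambda>(x', y). x' = x \<longrightarrow> y \<in> U) uniformity)"
    by (simp_all only: sgn_c0_def dist_c0_def uniformity_c0_def open_c0_def)
  have le_norm: "\<bar>c0_nth v k\<bar> \<le> norm v" for v k
    unfolding norm_c0_def by (rule cSUP_upper[OF _ bdd_above_c0_nth]) simp
  show "norm x = 0 \<longleftrightarrow> x = 0"
  proof
    assume "norm x = 0"
    then have "c0_nth x k = 0" for k
      using le_norm[of x k] by simp
    then show "x = 0"
      by transfer auto
  qed (simp add: norm_c0_def zero_c0.rep_eq)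
  show "norm (x + y) \<le> norm x + norm y"
    unfolding norm_c0_def[of "x + y"]
  proof (rule cSUP_least)
    fix k
    show "\<bar>c0_nth (x + y) k\<bar> \<le> norm x + norm y"
      using le_norm[of x k] le_norm[of y k] by (simp add: plus_c0.rep_eq)
  qed simp
  have scale_le: "norm (r *\<^sub>R v) \<le> \<bar>r\<bar> * norm v" for r and v :: c0
    unfolding norm_c0_def[of "r *\<^sub>R v"]
    by (rule cSUP_least) (auto simp: scaleR_c0.rep_eq abs_mult intro: mult_left_mono le_norm)
  show "norm (a *\<^sub>R x) = \<bar>a\<bar> * norm x"
  proof (cases "a = 0")
    case True
    have "(0 :: real) *\<^sub>R x = 0" by transfer simp
    with True show ?thesis
      by (simp add: norm_c0_def zero_c0.rep_eq)
  next
    case False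
    have "inverse a *\<^sub>R a *\<^sub>R x = x"
      using False by transfer auto
    with scale_le[of "inverse a" "a *\<^sub>R x"] have "norm x \<le> \<bar>inverse a\<bar> * norm (a *\<^sub>R x)"
      by simp
    with False have "\<bar>a\<bar> * norm x \<le> norm (a *\<^sub>R x)"
      by (simp add: field_simps)
    with scale_le[of a x] show ?thesis by simp
  qed
qed

end

lift_definition unit_vec :: "nat \<Rightarrow> c0" is "\<lambda>k j. if j = k then 1 else 0"
proof -
  fix k :: nat
  show "(\<lambda>j. if j = k then 1 else 0 :: real) \<longlonglongrightarrow> 0"
    by (rule tendsto_eventually) (auto intro: eventually_mono[OF eventually_gt_at_top[of k]])
qed

definition E :: "(nat \<Rightarrow> real) \<Rightarrow> c0 set" where
  "E \<gamma> = {x. \<forall>k. \<bar>c0_nth x k\<bar> \<le> \<gamma> k}"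

text \<open>Intended for probability measures on the Borel sets of a metric space; the real-valued
  supremum is then over a nonempty set bounded above by 1.\<close>

definition max_ball_mass :: "'a::metric_space measure \<Rightarrow> real \<Rightarrow> real" where
  "max_ball_mass \<mu> \<delta> = (SUP x. measure \<mu> (ball x \<delta>))"

definition generalized_mode :: "'a::metric_space measure \<Rightarrow> 'a \<Rightarrow> bool" where
  "generalized_mode \<mu> x \<longleftrightarrow>
     (\<forall>\<delta> :: nat \<Rightarrow> real. (\<forall>n. \<delta> n > 0) \<longrightarrow> \<delta> \<longlonglongrightarrow> 0 \<longrightarrow>
       (\<exists>w :: nat \<Rightarrow> 'a. w \<longlonglongrightarrow> x \<and>
         (\<lambda>n. measure \<mu> (ball (w n) (\<delta> n)) / max_ball_mass \<mu> (\<delta> n)) \<longlonglongrightarrow> 1))"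

text \<open>The series is taken in the norm topology of \<^typ>\<open>c0\<close>; where it diverges, \<^const>\<open>suminf\<close>
  returns a fixed junk value. For random variables taking values in \<open>[-1, 1]\<close> almost surely
  and \<open>\<gamma>\<close> tending to \<open>0\<close>, this only happens on a null set.\<close>

definition random_series :: "(nat \<Rightarrow> real) \<Rightarrow> (nat \<Rightarrow> 'a \<Rightarrow> real) \<Rightarrow> 'a \<Rightarrow> c0" where
  "random_series \<gamma> \<xi> \<omega> = (\<Sum>k. (\<gamma> k * \<xi> k \<omega>) *\<^sub>R unit_vec k)"

text \<open>Independent sequences of uniformly distributed variables on \<open>[-1, 1]\<close> exist: take the
  coordinates of a product space.\<close>

lemma iid_uniform_exists:
  defines "U \<equiv> uniform_measure lborel {-1..1::real}"
  defines "M \<equiv> PiM UNIV (\<lambda>_::nat. U)"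
  shows "prob_space M \<and> prob_space.indep_vars M (\<lambda>_. borel) (\<lambda>k \<omega>. \<omega> k) UNIV \<and> (\<forall>k. distr M borel (\<lambda>\<omega>. \<omega> k) = U)"
proof -
  have U: "prob_space U" unfolding U_def by (rule prob_space_uniform_measure) auto
  have s: "sets U = sets borel" by (simp add: U_def)
  interpret P: product_prob_space "\<lambda>_. U" UNIV by (simp add: product_prob_spaceI U)
  have pM: "prob_space M" unfolding M_def by (rule P.prob_space_axioms)
  then interpret M: prob_space M .
  have d: "distr M borel (\<lambda>\<omega>. \<omega> k) = U" for k
    using P.PiM_component[of k] distr_cong[OF refl s, of M "\<lambda>\<omega>. \<omega> k" "\<lambda>\<omega>. \<omega> k"] unfolding M_def by simp
  have rv: "(\<lambda>\<omega>. \<omega> k) \<in> borel_measurable M" for k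
    unfolding M_def using measurable_component_singleton[of k UNIV "\<lambda>_. U"] measurable_cong_sets[OF refl s] by blast
  have "distr M (PiM UNIV (\<lambda>_. borel)) (\<lambda>\<omega>. \<lambda>i\<in>UNIV. \<omega> i) = M"
  proof -
    have "distr M (PiM UNIV (\<lambda>_. borel)) (\<lambda>\<omega>. \<omega>) = distr M M (\<lambda>\<omega>. \<omega>)"
      by (rule distr_cong) (auto simp: M_def intro!: sets_PiM_cong s[symmetric])
    then show ?thesis by (simp add: restrict_UNIV)
  qed
  then have "M.indep_vars (\<lambda>_. borel) (\<lambda>k \<omega>. \<omega> k) UNIV"
    by (subst M.indep_vars_iff_distr_eq_PiM') (simp_all add: d rv M_def[symmetric] sets_PiM_cong)
  with pM d show ?thesis by blast
qed

end

theory Submission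
  imports Defs
begin

text \<open>
  A vector of \<^typ>\<open>c0\<close> attains its norm, so a ball of radius \<open>\<delta>\<close> is an open box with sides
  \<open>2\<delta>\<close>, and independence turns its mass into the product over \<open>k\<close> of the probabilities that
  \<open>\<gamma> k\<close> times a uniform variable falls within \<open>\<delta>\<close> of the \<open>k\<close>-th coordinate of the centre
  (\<open>ball_mass_eventually_prod\<close>). Since \<open>\<gamma>\<close> and the centre tend to \<open>0\<close>, all but finitely many
  factors are \<open>1\<close>, and no infinite products occur.

  Every factor has a maximum that does not depend on the centre, and it is attained when the
  coordinate has absolute value at most \<open>max 0 (\<gamma> k - \<delta>)\<close>: then the interval around it either
  stays inside \<open>[-\<gamma> k, \<gamma> k]\<close> or covers it. So every centre in this shrunken copy of
  \<^term>\<open>E \<gamma>\<close> has maximal ball mass (\<open>max_ball_mass_eq\<close>), and this mass is positive.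

  If \<open>x\<close> lies in \<^term>\<open>E \<gamma>\<close>, clamping its coordinates to the shrunken box moves it by at most
  \<open>\<delta>\<close> and yields centres with mass ratio exactly \<open>1\<close>. If \<open>\<bar>x k\<bar> > \<gamma> k\<close> for some \<open>k\<close>, then for
  centres near \<open>x\<close> and small radii the \<open>k\<close>-th factor vanishes, so the mass ratio is eventually \<open>0\<close>.
\<close>

section \<open>Coordinates in the space of null sequences\<close>

lemma abs_c0_nth_le_norm: "\<bar>c0_nth v k\<bar> \<le> norm v"
  unfolding norm_c0_def by (rule cSUP_upper[OF _ bdd_above_c0_nth]) simp

text \<open>The strict bound passes to the supremum because a tail of the sequence stays below
  \<open>d / 2\<close>, which leaves a maximum over finitely many coordinates.\<close>

lemma c0_norm_less_iff:
  assumes "0 < d"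
  shows "norm v < d \<longleftrightarrow> (\<forall>k. \<bar>c0_nth v k\<bar> < d)"
proof
  assume "norm v < d"
  then show "\<forall>k. \<bar>c0_nth v k\<bar> < d"
    using abs_c0_nth_le_norm le_less_trans by blast
next
  assume *: "\<forall>k. \<bar>c0_nth v k\<bar> < d"
  obtain K where K: "\<And>k. k \<ge> K \<Longrightarrow> \<bar>c0_nth v k\<bar> < d / 2"
    using LIMSEQ_D[OF c0_nth_tendsto, of "d / 2"] assms by auto
  define m where "m = Max (insert (d / 2) ((\<lambda>k. \<bar>c0_nth v k\<bar>) ` {..<K}))"
  have "\<bar>c0_nth v k\<bar> \<le> m" for k
  proof (cases "k < K")
    case True
    then show ?thesis unfolding m_def by (intro Max_ge) auto
  next
    case False
    then have "\<bar>c0_nth v k\<bar> \<le> d / 2" using K[of k] by simp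
    also have "d / 2 \<le> m" unfolding m_def by (intro Max_ge) auto
    finally show ?thesis .
  qed
  then have "norm v \<le> m"
    unfolding norm_c0_def by (intro cSUP_least) auto
  also have "m < d"
    unfolding m_def using * assms by (subst Max_less_iff) auto
  finally show "norm v < d" .
qed

lemma c0_mem_ball_iff:
  assumes "0 < d"
  shows "v \<in> ball w d \<longleftrightarrow> (\<forall>k. \<bar>c0_nth v k - c0_nth w k\<bar> < d)"
  using c0_norm_less_iff[OF assms, of "v - w"]
  unfolding mem_ball by (subst dist_commute) (simp add: dist_norm minus_c0.rep_eq)

lemma c0_nth_tendsto_coordinate:
  assumes "s \<longlonglongrightarrow> x"
  shows "(\<lambda>n. c0_nth (s n) k) \<longlonglongrightarrow> c0_nth x k"
proof (rule Lim_null_comparison[THEN LIM_zero_cancel])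
  show "\<forall>\<^sub>F n in sequentially. norm (c0_nth (s n) k - c0_nth x k) \<le> norm (s n - x)"
    using abs_c0_nth_le_norm[of "s _ - x" k] by (simp add: minus_c0.rep_eq)
  show "(\<lambda>n. norm (s n - x)) \<longlonglongrightarrow> 0"
    using assms by (simp add: LIM_zero tendsto_norm_zero)
qed

lemma c0_nth_sum_unit_vec:
  "c0_nth (\<Sum>k<n. a k *\<^sub>R unit_vec k) j = (if j < n then a j else 0)"
  by (induction n)
    (auto simp: zero_c0.rep_eq plus_c0.rep_eq scaleR_c0.rep_eq unit_vec.rep_eq less_Suc_eq)

lemma c0_sums_coordinates: "(\<lambda>k. c0_nth x k *\<^sub>R unit_vec k) sums x"
  unfolding sums_def
proof (rule LIMSEQ_I)
  fix r :: real
  assume r: "0 < r"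
  obtain K where K: "\<And>k. k \<ge> K \<Longrightarrow> \<bar>c0_nth x k\<bar> < r"
    using LIMSEQ_D[OF c0_nth_tendsto r] by auto
  show "\<exists>K. \<forall>n\<ge>K. norm ((\<Sum>k<n. c0_nth x k *\<^sub>R unit_vec k) - x) < r"
  proof (intro exI[of _ K] allI impI)
    fix n assume "K \<le> n"
    then show "norm ((\<Sum>k<n. c0_nth x k *\<^sub>R unit_vec k) - x) < r"
      using K r by (auto simp: c0_norm_less_iff minus_c0.rep_eq c0_nth_sum_unit_vec)
  qed
qed

lemma c0_nth_suminf_unit_vec:
  assumes "a \<longlonglongrightarrow> 0"
  shows "c0_nth (\<Sum>k. a k *\<^sub>R unit_vec k) = a"
proof -
  have a: "c0_nth (Abs_c0 a) = a"
    using assms by (simp add: Abs_c0_inverse)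
  show ?thesis
    using sums_unique[OF c0_sums_coordinates[of "Abs_c0 a"]] a by simp
qed

lemma unit_vec_series_tendsto_zero:
  assumes "(\<lambda>k. a k *\<^sub>R unit_vec k) sums s"
  shows "a \<longlonglongrightarrow> 0"
proof -
  have "c0_nth s k = a k" for k
  proof (rule LIMSEQ_unique)
    show "(\<lambda>n. c0_nth (\<Sum>k<n. a k *\<^sub>R unit_vec k) k) \<longlonglongrightarrow> c0_nth s k"
      using assms by (intro c0_nth_tendsto_coordinate) (simp add: sums_def)
    show "(\<lambda>n. c0_nth (\<Sum>k<n. a k *\<^sub>R unit_vec k) k) \<longlonglongrightarrow> a k"
      unfolding c0_nth_sum_unit_vec
      by (rule tendsto_eventually, rule eventually_mono[OF eventually_gt_at_top[of k]]) simp
  qed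
  then have "c0_nth s = a" by auto
  then show ?thesis using c0_nth_tendsto[of s] by simp
qed

text \<open>The second branch is the fixed value that \<^const>\<open>suminf\<close> takes at divergent series. It has
  to be made explicit because the series may diverge on a null set, while the law is only
  meaningful if the random series is measurable everywhere.\<close>

lemma c0_nth_random_series:
  "c0_nth (random_series \<gamma> \<xi> \<omega>) k =
     (if (\<lambda>j. \<gamma> j * \<xi> j \<omega>) \<longlonglongrightarrow> 0 then \<gamma> k * \<xi> k \<omega> else c0_nth (THE s. False) k)"
proof (cases "(\<lambda>j. \<gamma> j * \<xi> j \<omega>) \<longlonglongrightarrow> 0")
  case True
  then show ?thesis
    by (simp only: random_series_def c0_nth_suminf_unit_vec[OF True] if_True)
next
  case False
  then have "\<not> (\<lambda>j. (\<gamma> j * \<xi> j \<omega>) *\<^sub>R unit_vec j) sums s" for s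
    using unit_vec_series_tendsto_zero[of "\<lambda>j. \<gamma> j * \<xi> j \<omega>" s] by (rule contrapos_nn)
  then have "(sums) (\<lambda>j. (\<gamma> j * \<xi> j \<omega>) *\<^sub>R unit_vec j) = (\<lambda>s. False)"
    by (intro ext) simp
  then have "random_series \<gamma> \<xi> \<omega> = (THE s. False)"
    by (simp only: random_series_def suminf_def)
  then show ?thesis
    by (simp only: False if_False)
qed

text \<open>Each partial sum of the coordinate expansion is a continuous function of the sequence of
  coordinates in the product topology, where measurability can be tested coordinatewise, and
  the partial sums converge in norm.\<close>

lemma borel_measurable_c0_coordinatewise:
  assumes "\<And>k. (\<lambda>\<omega>. c0_nth (f \<omega>) k) \<in> borel_measurable M"
  shows "f \<in> borel_measurable M"
proof (rule borel_measurable_LIMSEQ_metric)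
  fix n
  have sum: "(\<lambda>a :: nat \<Rightarrow> real. \<Sum>k<n. a k *\<^sub>R unit_vec k) \<in> borel_measurable borel"
    by (intro borel_measurable_continuous_onI continuous_on_sum continuous_on_scaleR
        continuous_on_const continuous_on_product_coordinates)
  have coordinates: "(\<lambda>\<omega> k. c0_nth (f \<omega>) k) \<in> borel_measurable M"
    by (rule measurable_coordinatewise_then_product) (rule assms)
  show "(\<lambda>\<omega>. \<Sum>k<n. c0_nth (f \<omega>) k *\<^sub>R unit_vec k) \<in> borel_measurable M"
    by (rule measurable_compose[OF coordinates sum])
next
  fix \<omega>
  show "(\<lambda>n. \<Sum>k<n. c0_nth (f \<omega>) k *\<^sub>R unit_vec k) \<longlonglongrightarrow> f \<omega>"
    using c0_sums_coordinates by (simp add: sums_def)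
qed

section \<open>The mass of an interval under a scaled uniform variable\<close>

definition interval_mass :: "real \<Rightarrow> real \<Rightarrow> real \<Rightarrow> real" where
  "interval_mass g t d = measure (uniform_measure lborel {-1..1}) {u. \<bar>g * u - t\<bar> < d}"

definition max_interval_mass :: "real \<Rightarrow> real \<Rightarrow> real" where
  "max_interval_mass g d = (if d \<le> g then d / g else 1)"

lemma interval_mass_eq_lborel:
  "interval_mass g t d = measure lborel ({-1..1} \<inter> {u. \<bar>g * u - t\<bar> < d}) / 2"
  unfolding interval_mass_def by (subst measure_uniform_measure) auto

lemma slab_eq_interval:
  fixes g t d :: real
  assumes "0 < g"
  shows "{u. \<bar>g * u - t\<bar> < d} = {(t - d) / g <..< (t + d) / g}"
  using assms by (auto simp: field_simps abs_less_iff)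

lemma interval_mass_le_max:
  assumes "0 < d"
  shows "interval_mass g t d \<le> max_interval_mass g d"
proof (cases "d \<le> g")
  case True
  then have g: "0 < g" using assms by simp
  have "(t - d) / g \<le> (t + d) / g"
    using g assms by (simp add: divide_right_mono)
  then have *: "measure lborel {(t - d) / g <..< (t + d) / g} = 2 * (d / g)"
    by (simp add: diff_divide_distrib add_divide_distrib)
  have "measure lborel ({-1..1} \<inter> {(t - d) / g <..< (t + d) / g})
      \<le> measure lborel {(t - d) / g <..< (t + d) / g}"
    by (rule measure_mono_fmeasurable) (auto intro!: fmeasurableI emeasure_bounded_finite)
  then show ?thesis
    using True unfolding * interval_mass_eq_lborel slab_eq_interval[OF g] max_interval_mass_def
    by (simp only: if_True)
next
  case False
  have "measure lborel ({-1..1} \<inter> {u. \<bar>g * u - t\<bar> < d}) \<le> measure lborel {-1..1::real}"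
    by (rule measure_mono_fmeasurable) (auto intro!: fmeasurableI emeasure_bounded_finite)
  then show ?thesis
    using False by (simp add: interval_mass_eq_lborel max_interval_mass_def)
qed

lemma interval_mass_eq_max:
  assumes "0 \<le> g" "0 < d" and t: "\<bar>t\<bar> \<le> max 0 (g - d)"
  shows "interval_mass g t d = max_interval_mass g d"
proof (cases "d \<le> g")
  case True
  then have g: "0 < g" using assms by simp
  have "- 1 \<le> (t - d) / g" "(t + d) / g \<le> 1" "(t - d) / g \<le> (t + d) / g"
    using t True g assms by (auto simp: field_simps)
  moreover from this have "{-1..1} \<inter> {(t - d) / g <..< (t + d) / g} = {(t - d) / g <..< (t + d) / g}"
    by auto
  ultimately have "measure lborel ({-1..1} \<inter> {(t - d) / g <..< (t + d) / g}) = 2 * (d / g)"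
    by (simp add: diff_divide_distrib add_divide_distrib)
  then show ?thesis
    using True by (simp add: interval_mass_eq_lborel slab_eq_interval[OF g] max_interval_mass_def)
next
  case False
  then have "t = 0" using t by simp
  moreover have "\<bar>g * u\<bar> < d" if "u \<in> {-1..1}" for u
  proof -
    have "\<bar>g * u\<bar> \<le> g * 1"
      unfolding abs_mult using that assms by (intro mult_mono) auto
    then show ?thesis using False by simp
  qed
  ultimately have "{-1..1} \<inter> {u. \<bar>g * u - t\<bar> < d} = {-1..1}" by auto
  then show ?thesis
    using False by (simp add: interval_mass_eq_lborel max_interval_mass_def)
qed

lemma interval_mass_eq_0:
  assumes "0 \<le> g" and t: "g + d \<le> \<bar>t\<bar>"
  shows "interval_mass g t d = 0"
proof -
  have "\<not> \<bar>g * u - t\<bar> < d" if "u \<in> {-1..1}" for u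
  proof -
    have "\<bar>g * u\<bar> \<le> g * 1"
      unfolding abs_mult using that assms by (intro mult_mono) auto
    then show ?thesis using t by linarith
  qed
  then have "{-1..1} \<inter> {u. \<bar>g * u - t\<bar> < d} = {}" by auto
  then show ?thesis by (simp add: interval_mass_eq_lborel)
qed

lemma max_interval_mass_pos: "0 < d \<Longrightarrow> 0 < max_interval_mass g d"
  by (simp add: max_interval_mass_def)

section \<open>Ball masses of the random series\<close>

locale uniform_series = prob_space M
  for M :: "'a measure" and \<gamma> :: "nat \<Rightarrow> real" and \<xi> :: "nat \<Rightarrow> 'a \<Rightarrow> real" +
  assumes \<gamma>_nonneg: "\<And>k. 0 \<le> \<gamma> k"
    and \<gamma>_tendsto: "\<gamma> \<longlonglongrightarrow> 0"
    and indep: "indep_vars (\<lambda>_. borel) \<xi> UNIV"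
    and uniform: "\<And>k. distr M borel (\<xi> k) = uniform_measure lborel {-1..1}"
begin

abbreviation law :: "c0 measure" where
  "law \<equiv> distr M borel (random_series \<gamma> \<xi>)"

lemma measurable_\<xi> [measurable]: "\<xi> k \<in> borel_measurable M"
  using indep unfolding indep_vars_def by blast

lemma measurable_random_series [measurable]: "random_series \<gamma> \<xi> \<in> borel_measurable M"
proof (rule borel_measurable_c0_coordinatewise)
  fix k
  have "Measurable.pred M (\<lambda>\<omega>. (\<lambda>j. \<gamma> j * \<xi> j \<omega>) \<longlonglongrightarrow> 0)"
    by (rule measurable_limit) (intro borel_measurable_times borel_measurable_const measurable_\<xi>)
  then have "{\<omega> \<in> space M. (\<lambda>j. \<gamma> j * \<xi> j \<omega>) \<longlonglongrightarrow> 0} \<in> sets M"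
    by (rule predE)
  then show "(\<lambda>\<omega>. c0_nth (random_series \<gamma> \<xi> \<omega>) k) \<in> borel_measurable M"
    unfolding c0_nth_random_series
    by (intro measurable_If[rotated 2] borel_measurable_times borel_measurable_const measurable_\<xi>)
qed

lemma AE_abs_\<xi>_le_1: "AE \<omega> in M. \<forall>k. \<bar>\<xi> k \<omega>\<bar> \<le> 1"
proof (subst AE_all_countable, intro allI)
  fix k
  have "AE u in distr M borel (\<xi> k). \<bar>u\<bar> \<le> 1"
    unfolding uniform by (rule AE_uniform_measureI) auto
  then show "AE \<omega> in M. \<bar>\<xi> k \<omega>\<bar> \<le> 1"
    by (rule AE_distrD[OF measurable_\<xi>])
qed

lemma abs_scaled_le:
  assumes "\<bar>\<xi> k \<omega>\<bar> \<le> 1"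
  shows "\<bar>\<gamma> k * \<xi> k \<omega>\<bar> \<le> \<gamma> k"
  using mult_left_mono[OF assms \<gamma>_nonneg[of k]] \<gamma>_nonneg[of k] by (simp add: abs_mult)

lemma c0_nth_random_series_bounded:
  assumes "\<And>k. \<bar>\<xi> k \<omega>\<bar> \<le> 1"
  shows "c0_nth (random_series \<gamma> \<xi> \<omega>) k = \<gamma> k * \<xi> k \<omega>"
proof -
  have "(\<lambda>k. \<gamma> k * \<xi> k \<omega>) \<longlonglongrightarrow> 0"
    using abs_scaled_le[OF assms] by (intro Lim_null_comparison[OF _ \<gamma>_tendsto]) auto
  then show ?thesis by (simp add: c0_nth_random_series)
qed

lemma prob_scaled_\<xi>:
  "prob (\<xi> k -` {u. \<bar>\<gamma> k * u - t\<bar> < d} \<inter> space M) = interval_mass (\<gamma> k) t d"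
  unfolding interval_mass_def uniform[of k, symmetric] by (subst measure_distr) auto

text \<open>Once \<open>\<gamma> k + \<bar>w k\<bar> < d\<close>, the constraint on coordinate \<open>k\<close> holds almost surely, so membership
  in the ball depends on finitely many of the independent variables. The product formula is
  stated for all large \<open>N\<close> so that two balls can be compared with a common \<open>N\<close>.\<close>

lemma ball_mass_eventually_prod:
  assumes d: "0 < d"
  shows "\<forall>\<^sub>F N in sequentially.
    measure law (ball w d) = (\<Prod>k\<le>N. interval_mass (\<gamma> k) (c0_nth w k) d)"
proof -
  have "(\<lambda>k. \<gamma> k + \<bar>c0_nth w k\<bar>) \<longlonglongrightarrow> 0"
    using tendsto_add[OF \<gamma>_tendsto tendsto_rabs_zero[OF c0_nth_tendsto]] by simp
  then have "\<forall>\<^sub>F k in sequentially. \<gamma> k + \<bar>c0_nth w k\<bar> < d"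
    using d by (rule order_tendstoD(2))
  then obtain K where K: "\<And>k. k \<ge> K \<Longrightarrow> \<gamma> k + \<bar>c0_nth w k\<bar> < d"
    by (auto simp: eventually_sequentially)
  have "measure law (ball w d) = (\<Prod>k\<le>N. interval_mass (\<gamma> k) (c0_nth w k) d)" if N: "K \<le> N" for N
  proof -
    define A where "A k = {u. \<bar>\<gamma> k * u - c0_nth w k\<bar> < d}" for k
    have [measurable]: "A k \<in> sets borel" for k unfolding A_def by measurable
    have "measure law (ball w d) = prob (random_series \<gamma> \<xi> -` ball w d \<inter> space M)"
      by (rule measure_distr) auto
    also have "\<dots> = prob (\<Inter>k\<in>{..N}. \<xi> k -` A k \<inter> space M)"
    proof (rule finite_measure_eq_AE)
      show "AE \<omega> in M. \<omega> \<in> random_series \<gamma> \<xi> -` ball w d \<inter> space M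
          \<longleftrightarrow> \<omega> \<in> (\<Inter>k\<in>{..N}. \<xi> k -` A k \<inter> space M)"
        using AE_abs_\<xi>_le_1 AE_space
      proof eventually_elim
        fix \<omega> assume b: "\<forall>k. \<bar>\<xi> k \<omega>\<bar> \<le> 1" and \<omega>: "\<omega> \<in> space M"
        have tail: "\<bar>\<gamma> k * \<xi> k \<omega> - c0_nth w k\<bar> < d" if "\<not> k \<le> N" for k
          using K[of k] that N abs_scaled_le[of k \<omega>] b by fastforce
        have "random_series \<gamma> \<xi> \<omega> \<in> ball w d \<longleftrightarrow> (\<forall>k. \<bar>\<gamma> k * \<xi> k \<omega> - c0_nth w k\<bar> < d)"
          unfolding c0_mem_ball_iff[OF d] using b by (simp add: c0_nth_random_series_bounded)
        also have "\<dots> \<longleftrightarrow> (\<forall>k\<le>N. \<bar>\<gamma> k * \<xi> k \<omega> - c0_nth w k\<bar> < d)"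
          using tail by blast
        finally show "\<omega> \<in> random_series \<gamma> \<xi> -` ball w d \<inter> space M
            \<longleftrightarrow> \<omega> \<in> (\<Inter>k\<in>{..N}. \<xi> k -` A k \<inter> space M)"
          using \<omega> by (auto simp: A_def)
      qed
    qed (auto intro!: measurable_sets[OF measurable_random_series] sets.finite_INT
        measurable_sets[OF measurable_\<xi>])
    also have "\<dots> = (\<Prod>k\<le>N. prob (\<xi> k -` A k \<inter> space M))"
      by (rule indep_varsD[OF indep]) auto
    also have "\<dots> = (\<Prod>k\<le>N. interval_mass (\<gamma> k) (c0_nth w k) d)"
      unfolding A_def prob_scaled_\<xi> ..
    finally show ?thesis .
  qed
  then show ?thesis by (auto simp: eventually_sequentially)
qed

lemma ball_mass_le:
  assumes d: "0 < d" and v: "\<And>k. \<bar>c0_nth v k\<bar> \<le> max 0 (\<gamma> k - d)"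
  shows "measure law (ball w d) \<le> measure law (ball v d)"
proof -
  have "\<forall>\<^sub>F N in sequentially. measure law (ball w d) \<le> measure law (ball v d)"
    using ball_mass_eventually_prod[OF d, of w] ball_mass_eventually_prod[OF d, of v]
  proof eventually_elim
    case (elim N)
    have "interval_mass (\<gamma> k) (c0_nth w k) d \<le> interval_mass (\<gamma> k) (c0_nth v k) d" for k
      using interval_mass_le_max[OF d] interval_mass_eq_max[OF \<gamma>_nonneg d v] by simp
    then show ?case
      unfolding elim by (intro prod_mono) (simp add: interval_mass_def)
  qed
  then show ?thesis by simp
qed

lemma max_ball_mass_eq:
  assumes "0 < d" "\<And>k. \<bar>c0_nth v k\<bar> \<le> max 0 (\<gamma> k - d)"
  shows "max_ball_mass law d = measure law (ball v d)"
  unfolding max_ball_mass_def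
  by (rule cSup_eq_maximum) (auto intro: ball_mass_le[OF assms])

lemma max_ball_mass_pos:
  assumes d: "0 < d"
  shows "0 < max_ball_mass law d"
proof -
  have c: "\<bar>c0_nth 0 k\<bar> \<le> max 0 (\<gamma> k - d)" for k
    by (simp add: zero_c0.rep_eq)
  obtain N where "measure law (ball 0 d) = (\<Prod>k\<le>N. interval_mass (\<gamma> k) (c0_nth 0 k) d)"
    using eventually_happens'[OF _ ball_mass_eventually_prod[OF d, of 0]] by auto
  also have "\<dots> = (\<Prod>k\<le>N. max_interval_mass (\<gamma> k) d)"
    using interval_mass_eq_max[OF \<gamma>_nonneg d c] by simp
  also have "\<dots> > 0"
    using max_interval_mass_pos[OF d] by (intro prod_pos) simp
  finally show ?thesis
    using max_ball_mass_eq[OF d c] by simp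
qed

lemma ball_mass_eq_0:
  assumes d: "0 < d" and k: "\<gamma> k + d \<le> \<bar>c0_nth w k\<bar>"
  shows "measure law (ball w d) = 0"
proof -
  have "\<forall>\<^sub>F N in sequentially. measure law (ball w d) = 0"
    using ball_mass_eventually_prod[OF d, of w] eventually_ge_at_top[of k]
  proof eventually_elim
    case (elim N)
    have "interval_mass (\<gamma> k) (c0_nth w k) d = 0"
      by (rule interval_mass_eq_0[OF \<gamma>_nonneg k])
    then show ?case
      unfolding elim(1) using elim(2) by (intro prod_zero) auto
  qed
  then show ?thesis by simp
qed

section \<open>Generalized modes\<close>

text \<open>The bound on the distance is the reason why clamping works: if \<open>d \<le> \<gamma> k\<close>, each end of
  \<open>[-\<gamma> k, \<gamma> k]\<close> moves inwards by \<open>d\<close>, and otherwise the whole interval has radius below \<open>d\<close>.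
  So no coordinate moves by more than \<open>d\<close>; the factor \<open>2\<close> serves to have a strict bound, which
  is the form in which the norm is controlled by coordinates.\<close>

lemma exists_near_maximizer:
  assumes x: "x \<in> E \<gamma>" and d: "0 < d"
  shows "\<exists>v. norm (v - x) < 2 * d \<and> (\<forall>k. \<bar>c0_nth v k\<bar> \<le> max 0 (\<gamma> k - d))"
proof -
  define r where "r k = max 0 (\<gamma> k - d)" for k
  define a where "a k = max (- r k) (min (r k) (c0_nth x k))" for k
  have xk: "\<bar>c0_nth x k\<bar> \<le> \<gamma> k" for k using x by (simp add: E_def)
  have a_le: "\<bar>a k\<bar> \<le> r k" and near: "\<bar>a k - c0_nth x k\<bar> \<le> d" for k
    using xk[of k] d unfolding a_def r_def by auto
  have "\<bar>a k\<bar> \<le> \<gamma> k" for k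
    using a_le[of k] d \<gamma>_nonneg[of k] unfolding r_def by auto
  then have "a \<longlonglongrightarrow> 0"
    by (intro Lim_null_comparison[OF _ \<gamma>_tendsto]) auto
  then have a: "c0_nth (Abs_c0 a) = a"
    by (simp add: Abs_c0_inverse)
  have "\<bar>a k - c0_nth x k\<bar> < 2 * d" for k
    using near[of k] d by linarith
  then have "norm (Abs_c0 a - x) < 2 * d"
    using d by (simp add: c0_norm_less_iff minus_c0.rep_eq a)
  then show ?thesis
    using a_le by (intro exI[of _ "Abs_c0 a"]) (simp add: a r_def)
qed

lemma generalized_mode_if_mem_E:
  assumes x: "x \<in> E \<gamma>"
  shows "generalized_mode law x"
  unfolding generalized_mode_def
proof (intro allI impI)
  fix \<delta> :: "nat \<Rightarrow> real"
  assume pos: "\<forall>n. 0 < \<delta> n" and lim: "\<delta> \<longlonglongrightarrow> 0"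
  have "\<exists>w. \<forall>n. norm (w n - x) < 2 * \<delta> n \<and> (\<forall>k. \<bar>c0_nth (w n) k\<bar> \<le> max 0 (\<gamma> k - \<delta> n))"
    using exists_near_maximizer[OF x] pos by (intro choice) blast
  then obtain w where near: "\<And>n. norm (w n - x) < 2 * \<delta> n"
    and max: "\<And>n k. \<bar>c0_nth (w n) k\<bar> \<le> max 0 (\<gamma> k - \<delta> n)" by blast
  have "(\<lambda>n. w n - x) \<longlonglongrightarrow> 0"
  proof (rule Lim_null_comparison)
    show "\<forall>\<^sub>F n in sequentially. norm (w n - x) \<le> 2 * \<delta> n"
      by (intro always_eventually allI less_imp_le near)
    show "(\<lambda>n. 2 * \<delta> n) \<longlonglongrightarrow> 0"
      by (rule tendsto_mult_right_zero[OF lim])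
  qed
  then have w_lim: "w \<longlonglongrightarrow> x" by (rule LIM_zero_cancel)
  have ratio: "measure law (ball (w n) (\<delta> n)) / max_ball_mass law (\<delta> n) = 1" for n
    using max_ball_mass_eq[of "\<delta> n" "w n"] max_ball_mass_pos[of "\<delta> n"] pos max by simp
  show "\<exists>w. w \<longlonglongrightarrow> x \<and>
      (\<lambda>n. measure law (ball (w n) (\<delta> n)) / max_ball_mass law (\<delta> n)) \<longlonglongrightarrow> 1"
    by (intro exI[of _ w] conjI w_lim) (simp only: ratio tendsto_const)
qed

lemma mem_E_if_generalized_mode:
  assumes mode: "generalized_mode law x"
  shows "x \<in> E \<gamma>"
proof (rule ccontr)
  assume "x \<notin> E \<gamma>"
  then obtain k where k: "\<gamma> k < \<bar>c0_nth x k\<bar>" by (auto simp: E_def not_le)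
  define \<delta> where "\<delta> n = inverse (real (Suc n))" for n
  have lim: "\<delta> \<longlonglongrightarrow> 0" unfolding \<delta>_def by (rule LIMSEQ_inverse_real_of_nat)
  have pos: "0 < \<delta> n" for n by (simp add: \<delta>_def)
  obtain w where w: "w \<longlonglongrightarrow> x"
    and ratio: "(\<lambda>n. measure law (ball (w n) (\<delta> n)) / max_ball_mass law (\<delta> n)) \<longlonglongrightarrow> 1"
    using mode lim pos unfolding generalized_mode_def by blast
  have "(\<lambda>n. \<bar>c0_nth (w n) k\<bar> - \<delta> n) \<longlonglongrightarrow> \<bar>c0_nth x k\<bar> - 0"
    by (intro tendsto_diff tendsto_rabs c0_nth_tendsto_coordinate w lim)
  then have "\<forall>\<^sub>F n in sequentially. \<gamma> k < \<bar>c0_nth (w n) k\<bar> - \<delta> n"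
    using k by (intro order_tendstoD(1)) auto
  then have "\<forall>\<^sub>F n in sequentially.
      measure law (ball (w n) (\<delta> n)) / max_ball_mass law (\<delta> n) = 0"
  proof eventually_elim
    case (elim n)
    then have "measure law (ball (w n) (\<delta> n)) = 0"
      by (intro ball_mass_eq_0[OF pos, of k]) linarith
    then show ?case by simp
  qed
  then have "(\<lambda>n. measure law (ball (w n) (\<delta> n)) / max_ball_mass law (\<delta> n)) \<longlonglongrightarrow> 0"
    by (rule tendsto_eventually)
  from LIMSEQ_unique[OF ratio this] show False by simp
qed

end

theorem theorem4p13:
  fixes \<gamma> :: "nat \<Rightarrow> real"
    and M :: "'a measure"
    and \<xi> :: "nat \<Rightarrow> 'a \<Rightarrow> real"
    and \<mu> :: "c0 measure"
    and x :: c0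
  assumes "\<And>k. \<gamma> k \<ge> 0"
    and "\<gamma> \<longlonglongrightarrow> 0"
    and "prob_space M"
    and "prob_space.indep_vars M (\<lambda>_. borel) \<xi> UNIV"
    and "\<And>k. distr M borel (\<xi> k) = uniform_measure lborel {-1..1}"
    and "\<mu> = distr M borel (random_series \<gamma> \<xi>)"
  shows "generalized_mode \<mu> x \<longleftrightarrow> x \<in> E \<gamma>"
proof -
  interpret prob_space M by fact
  interpret uniform_series M \<gamma> \<xi> by unfold_locales fact+
  show ?thesis
    unfolding assms(6) using generalized_mode_if_mem_E mem_E_if_generalized_mode by blast
qed

end
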